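(* Let $\Sigma\subseteq\{\veebar,\wedge,\vee,\mathbin{\barwedge},\mathbin{\dot\vee},\mathbin{\dot\barwedge}\}$, let $\mathbb{A}_0,\mathbb{B}_0$ be sets of $\Phi$-teams and $k_0\in\mathbb{N}$. Then S has a winning strategy in the game $\mathrm{FS}^\Sigma_{k_0}(\mathbb{A}_0,\mathbb{B}_0)$ if and only if there is a formula $\varphi\in\mathrm{PL}(\Sigma)$ with $\mathrm{wd}(\varphi)\leq k_0$ which separates $\mathbb{A}_0$ from $\mathbb{B}_0$.
   Context: A domain $\Phi$ is a finite set of propositional variables; a $\Phi$-team is a set of maps $\Phi\to\{0,1\}$. A split of $T$ is $(T_1,T_2)$ with $T_1,T_2\subseteq T$, $T_1\cup T_2=T$; strict if $T_1\cap T_2=\emptyset$; $\mathrm{Sp}(T)$ and $\mathrm{SSp}(T)$ denote the sets of splits and strict splits. $\Phi$-literals: $\top,\bot,{\sim}\top,{\sim}\bot,p,\neg p,{\sim}p,{\sim}\neg p$ ($p\in\Phi$); $\mathrm{PL}(\Sigma)$ is the set of formulas built from $\Phi$-literals using connectives in $\Sigma$. Semantics: $T\models\top$ always; $T\models\bot$ iff $T=\emptyset$; $T\models p$ iff $s(p)=1$ for all $s\in T$; $T\models\neg p$ iff $s(p)=0$ for all $s\in T$; $T\models{\sim}\ell$ iff $T\not\models\ell$; $\wedge$ conjunction; $T\models\psi\veebar\theta$ iff $T\models\psi$ or $T\models\theta$; $T\models\psi\vee\theta$ iff some $(S,U)\in\mathrm{Sp}(T)$ has $S\models\psi$ and $U\models\theta$;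 $T\models\psi\mathbin{\barwedge}\theta$ iff every $(S,U)\in\mathrm{Sp}(T)$ has $S\models\psi$ or $U\models\theta$; $\mathbin{\dot\vee}$ and $\mathbin{\dot\barwedge}$ are the same with $\mathrm{SSp}(T)$. Width: $\mathrm{wd}(\ell)=1$ for literals, $\mathrm{wd}(\psi\circ\theta)=\mathrm{wd}(\psi)+\mathrm{wd}(\theta)$. A formula $\varphi$ separates $\mathbb{A}$ from $\mathbb{B}$ if $A\models\varphi$ for all $A\in\mathbb{A}$ and $B\not\models\varphi$ for all $B\in\mathbb{B}$. The game $\mathrm{FS}^\Sigma_{k_0}(\mathbb{A}_0,\mathbb{B}_0)$ between players S and D has positions $(k,\mathbb{A},\mathbb{B})$ ($k\in\mathbb{N}$, $\mathbb{A},\mathbb{B}$ sets of $\Phi$-teams), starting at $(k_0,\mathbb{A}_0,\mathbb{B}_0)$. If $k_0=0$, D wins. In a position with $k\geq1$, S makes one of the following moves (a connective move only for connectives in $\Sigma$); in each connective move S also chooses $k_1,k_2>0$ with $k_1+k_2=k$, then D chooses $i\in\{1,2\}$ and play continues from the indicated position. $\veebar$-move: S chooses $\mathbb{A}_1,\mathbb{A}_2\subseteq\mathbb{A}$ with $\mathbb{A}_1\cup\mathbb{A}_2=\mathbb{A}$; next position $(k_i,\mathbb{A}_i,\mathbb{B})$. $\wedge$-move: S chooses $\mathbb{B}_1,\mathbb{B}_2\subseteq\mathbb{B}$ with union $\mathbb{B}$; next $(k_i,\mathbb{A},\mathbb{B}_i)$. $\vee$-move: for each $A\in\mathbb{A}$,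 S chooses a split $(A_1,A_2)\in\mathrm{Sp}(A)$, and for each $B\in\mathbb{B}$ a function $f_B:\mathrm{Sp}(B)\to\{1,2\}$; let $\mathbb{A}_i=\{A_i:A\in\mathbb{A}\}$ and $\mathbb{B}_i=\{B_i: B\in\mathbb{B},(B_1,B_2)\in\mathrm{Sp}(B),f_B(B_1,B_2)=i\}$; next $(k_i,\mathbb{A}_i,\mathbb{B}_i)$. $\mathbin{\barwedge}$-move: as the $\vee$-move with the roles of $\mathbb{A}$ and $\mathbb{B}$ swapped. $\mathbin{\dot\vee}$-move and $\mathbin{\dot\barwedge}$-move: as the $\vee$- and $\mathbin{\barwedge}$-moves but with only strict splits. Literal move: S chooses a $\Phi$-literal $\ell$; S wins if $\ell$ separates $\mathbb{A}$ from $\mathbb{B}$, otherwise D wins. *)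

theory Defs
  imports Main "HOL-Library.FuncSet"
begin

type_synonym 'p team = "('p \<Rightarrow> bool) set"

(* Maps from Phi to the two truth values are functions that are undefined outside Phi, so the
   empty domain has exactly one assignment. *)
definition teams :: "'p set \<Rightarrow> 'p team set" where
  "teams \<Phi> = Pow (\<Phi> \<rightarrow>\<^sub>E (UNIV :: bool set))"

definition Sp :: "'p team \<Rightarrow> ('p team \<times> 'p team) set" where
  "Sp T = {(T1, T2). T1 \<subseteq> T \<and> T2 \<subseteq> T \<and> T1 \<union> T2 = T}"

definition SSp :: "'p team \<Rightarrow> ('p team \<times> 'p team) set" where
  "SSp T = {(T1, T2). (T1, T2) \<in> Sp T \<and> T1 \<inter> T2 = {}}"

datatype 'p base_literal = Top | Bot | Var 'p | NegVar 'p

(* Tilde is the contradictory negation, written with a tilde in front of a literal;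
   NegVar is the dual negation of a variable. *)
datatype 'p literal = Base "'p base_literal" | Tilde "'p base_literal"

definition base_literals :: "'p set \<Rightarrow> 'p base_literal set" where
  "base_literals \<Phi> = {Top, Bot} \<union> Var ` \<Phi> \<union> NegVar ` \<Phi>"

definition literals :: "'p set \<Rightarrow> 'p literal set" where
  "literals \<Phi> = Base ` base_literals \<Phi> \<union> Tilde ` base_literals \<Phi>"

(* In LaTeX: veebar, wedge, vee, barwedge, dot vee, dot barwedge. *)
datatype connective = Bool_Or | And | Split_Or | Split_And | Strict_Or | Strict_And

datatype 'p form = Lit "'p literal" | Conn connective "'p form" "'p form"

inductive_set PL :: "'p set \<Rightarrow> connective set \<Rightarrow> 'p form set"
  for \<Phi> :: "'p set" and \<Sigma> :: "connective set" where
  "l \<in> literals \<Phi> \<Longrightarrow> Lit l \<in> PL \<Phi> \<Sigma>"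
| "c \<in> \<Sigma> \<Longrightarrow> \<psi> \<in> PL \<Phi> \<Sigma> \<Longrightarrow> \<theta> \<in> PL \<Phi> \<Sigma> \<Longrightarrow> Conn c \<psi> \<theta> \<in> PL \<Phi> \<Sigma>"

fun sat_base :: "'p team \<Rightarrow> 'p base_literal \<Rightarrow> bool" where
  "sat_base T Top \<longleftrightarrow> True"
| "sat_base T Bot \<longleftrightarrow> T = {}"
| "sat_base T (Var p) \<longleftrightarrow> (\<forall>s\<in>T. s p)"
| "sat_base T (NegVar p) \<longleftrightarrow> (\<forall>s\<in>T. \<not> s p)"

fun sat_literal :: "'p team \<Rightarrow> 'p literal \<Rightarrow> bool" where
  "sat_literal T (Base b) \<longleftrightarrow> sat_base T b"
| "sat_literal T (Tilde b) \<longleftrightarrow> \<not> sat_base T b"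

fun sat :: "'p team \<Rightarrow> 'p form \<Rightarrow> bool"  (infix "\<Turnstile>" 50) where
  "T \<Turnstile> Lit l \<longleftrightarrow> sat_literal T l"
| "T \<Turnstile> Conn And \<psi> \<theta> \<longleftrightarrow> T \<Turnstile> \<psi> \<and> T \<Turnstile> \<theta>"
| "T \<Turnstile> Conn Bool_Or \<psi> \<theta> \<longleftrightarrow> T \<Turnstile> \<psi> \<or> T \<Turnstile> \<theta>"
| "T \<Turnstile> Conn Split_Or \<psi> \<theta> \<longleftrightarrow> (\<exists>(S, U) \<in> Sp T. S \<Turnstile> \<psi> \<and> U \<Turnstile> \<theta>)"
| "T \<Turnstile> Conn Split_And \<psi> \<theta> \<longleftrightarrow> (\<forall>(S, U) \<in> Sp T. S \<Turnstile> \<psi> \<or> U \<Turnstile> \<theta>)"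
| "T \<Turnstile> Conn Strict_Or \<psi> \<theta> \<longleftrightarrow> (\<exists>(S, U) \<in> SSp T. S \<Turnstile> \<psi> \<and> U \<Turnstile> \<theta>)"
| "T \<Turnstile> Conn Strict_And \<psi> \<theta> \<longleftrightarrow> (\<forall>(S, U) \<in> SSp T. S \<Turnstile> \<psi> \<or> U \<Turnstile> \<theta>)"

fun wd :: "'p form \<Rightarrow> nat" where
  "wd (Lit l) = 1"
| "wd (Conn c \<psi> \<theta>) = wd \<psi> + wd \<theta>"

definition separates :: "'p form \<Rightarrow> 'p team set \<Rightarrow> 'p team set \<Rightarrow> bool" where
  "separates \<phi> \<A> \<B> \<longleftrightarrow> (\<forall>A\<in>\<A>. A \<Turnstile> \<phi>) \<and> (\<forall>B\<in>\<B>. \<not> B \<Turnstile> \<phi>)"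

datatype index = One | Two

fun component :: "index \<Rightarrow> 'a \<times> 'a \<Rightarrow> 'a" where
  "component One (x, y) = x"
| "component Two (x, y) = y"

type_synonym 'p position = "nat \<times> 'p team set \<times> 'p team set"

type_synonym 'p split_choice = "'p team \<Rightarrow> 'p team \<times> 'p team"

type_synonym 'p index_choice = "'p team \<Rightarrow> 'p team \<times> 'p team \<Rightarrow> index"

(* What S chooses in a connective move, apart from k1 and k2. A split_choice selects one split of
   each team on one side; an index_choice is the family of functions f_B from the splits of B
   to the indices, for the teams B on the other side. *)
datatype 'p choice =
    Bool_Or_Choice "'p team set" "'p team set"
  | And_Choice "'p team set" "'p team set"
  | Split_Or_Choice "'p split_choice" "'p index_choice"
  | Split_And_Choice "'p split_choice" "'p index_choice"
  | Strict_Or_Choice "'p split_choice" "'p index_choice"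
  | Strict_And_Choice "'p split_choice" "'p index_choice"

datatype 'p move = Literal_Move "'p literal" | Connective_Move nat nat "'p choice"

fun connective_of :: "'p choice \<Rightarrow> connective" where
  "connective_of (Bool_Or_Choice _ _) = Bool_Or"
| "connective_of (And_Choice _ _) = And"
| "connective_of (Split_Or_Choice _ _) = Split_Or"
| "connective_of (Split_And_Choice _ _) = Split_And"
| "connective_of (Strict_Or_Choice _ _) = Strict_Or"
| "connective_of (Strict_And_Choice _ _) = Strict_And"

fun admissible :: "'p team set \<Rightarrow> 'p team set \<Rightarrow> 'p choice \<Rightarrow> bool" where
  "admissible \<A> \<B> (Bool_Or_Choice \<A>1 \<A>2) \<longleftrightarrow> \<A>1 \<subseteq> \<A> \<and> \<A>2 \<subseteq> \<A> \<and> \<A>1 \<union> \<A>2 = \<A>"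
| "admissible \<A> \<B> (And_Choice \<B>1 \<B>2) \<longleftrightarrow> \<B>1 \<subseteq> \<B> \<and> \<B>2 \<subseteq> \<B> \<and> \<B>1 \<union> \<B>2 = \<B>"
| "admissible \<A> \<B> (Split_Or_Choice g f) \<longleftrightarrow> (\<forall>A\<in>\<A>. g A \<in> Sp A)"
| "admissible \<A> \<B> (Split_And_Choice g f) \<longleftrightarrow> (\<forall>B\<in>\<B>. g B \<in> Sp B)"
| "admissible \<A> \<B> (Strict_Or_Choice g f) \<longleftrightarrow> (\<forall>A\<in>\<A>. g A \<in> SSp A)"
| "admissible \<A> \<B> (Strict_And_Choice g f) \<longleftrightarrow> (\<forall>B\<in>\<B>. g B \<in> SSp B)"

definition chosen_parts :: "'p split_choice \<Rightarrow> index \<Rightarrow> 'p team set \<Rightarrow> 'p team set" where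
  "chosen_parts g i \<T> = {component i (g T) | T. T \<in> \<T>}"

definition indexed_parts ::
  "('p team \<Rightarrow> ('p team \<times> 'p team) set) \<Rightarrow> 'p index_choice \<Rightarrow> index \<Rightarrow> 'p team set \<Rightarrow> 'p team set" where
  "indexed_parts splits f i \<T> = {component i s | T s. T \<in> \<T> \<and> s \<in> splits T \<and> f T s = i}"

fun next_sets ::
  "'p team set \<Rightarrow> 'p team set \<Rightarrow> 'p choice \<Rightarrow> index \<Rightarrow> 'p team set \<times> 'p team set" where
  "next_sets \<A> \<B> (Bool_Or_Choice \<A>1 \<A>2) i = (component i (\<A>1, \<A>2), \<B>)"
| "next_sets \<A> \<B> (And_Choice \<B>1 \<B>2) i = (\<A>, component i (\<B>1, \<B>2))"
| "next_sets \<A> \<B> (Split_Or_Choice g f) i = (chosen_parts g i \<A>, indexed_parts Sp f i \<B>)"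
| "next_sets \<A> \<B> (Split_And_Choice g f) i = (indexed_parts Sp f i \<A>, chosen_parts g i \<B>)"
| "next_sets \<A> \<B> (Strict_Or_Choice g f) i = (chosen_parts g i \<A>, indexed_parts SSp f i \<B>)"
| "next_sets \<A> \<B> (Strict_And_Choice g f) i = (indexed_parts SSp f i \<A>, chosen_parts g i \<B>)"

fun legal :: "'p set \<Rightarrow> connective set \<Rightarrow> 'p position \<Rightarrow> 'p move \<Rightarrow> bool" where
  "legal \<Phi> \<Sigma> (k, \<A>, \<B>) (Literal_Move l) \<longleftrightarrow> k \<ge> 1 \<and> l \<in> literals \<Phi>"
| "legal \<Phi> \<Sigma> (k, \<A>, \<B>) (Connective_Move k1 k2 c) \<longleftrightarrow>
     k \<ge> 1 \<and> k1 > 0 \<and> k2 > 0 \<and> k1 + k2 = k \<and> connective_of c \<in> \<Sigma> \<and> admissible \<A> \<B> c"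

(* A history lists the completed rounds: the connective move made by S and the index chosen by D. *)
type_synonym 'p history = "('p move \<times> index) list"

type_synonym 'p strategy = "'p history \<Rightarrow> 'p move"

(* reached Phi Sigma strat p0 h p: in a play from p0 in which S follows strat, h is the history
   when the position p is reached. *)
inductive reached ::
  "'p set \<Rightarrow> connective set \<Rightarrow> 'p strategy \<Rightarrow> 'p position \<Rightarrow> 'p history \<Rightarrow> 'p position \<Rightarrow> bool"
  for \<Phi> :: "'p set" and \<Sigma> :: "connective set" and \<sigma> :: "'p strategy" and p0 :: "'p position" where
  "reached \<Phi> \<Sigma> \<sigma> p0 [] p0"
| "reached \<Phi> \<Sigma> \<sigma> p0 h (k, \<A>, \<B>) \<Longrightarrow> \<sigma> h = Connective_Move k1 k2 c \<Longrightarrow>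
     legal \<Phi> \<Sigma> (k, \<A>, \<B>) (\<sigma> h) \<Longrightarrow>
     reached \<Phi> \<Sigma> \<sigma> p0 (h @ [(\<sigma> h, i)]) (component i (k1, k2), next_sets \<A> \<B> c i)"

(* No play is infinite, because k strictly decreases in every connective move. Hence S wins every
   play in which S follows strat iff strat always prescribes a legal move and every literal move it
   prescribes is a winning one. No move is legal when k = 0, so that D wins in that case. *)
definition winning_strategy ::
  "'p set \<Rightarrow> connective set \<Rightarrow> 'p position \<Rightarrow> 'p strategy \<Rightarrow> bool" where
  "winning_strategy \<Phi> \<Sigma> p0 \<sigma> \<longleftrightarrow>
     (\<forall>h k \<A> \<B>. reached \<Phi> \<Sigma> \<sigma> p0 h (k, \<A>, \<B>) \<longrightarrow>
        legal \<Phi> \<Sigma> (k, \<A>, \<B>) (\<sigma> h) \<and>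
        (\<forall>l. \<sigma> h = Literal_Move l \<longrightarrow> separates (Lit l) \<A> \<B>))"

definition S_has_winning_strategy ::
  "'p set \<Rightarrow> connective set \<Rightarrow> nat \<Rightarrow> 'p team set \<Rightarrow> 'p team set \<Rightarrow> bool" where
  "S_has_winning_strategy \<Phi> \<Sigma> k0 \<A>0 \<B>0 \<longleftrightarrow> (\<exists>\<sigma>. winning_strategy \<Phi> \<Sigma> (k0, \<A>0, \<B>0) \<sigma>)"

lemma connective_move_decreases:
  assumes "legal \<Phi> \<Sigma> (k, \<A>, \<B>) (Connective_Move k1 k2 c)"
  shows "component i (k1, k2) < k"
  using assms by (cases i) auto

end

theory Submission
  imports Defs
begin

text \<open>Let \<open>W\<close> be a set of positions. If S can move from every position of \<open>W\<close> either to an immediate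
  win or so that D has to stay in \<open>W\<close>, then S wins from all of \<open>W\<close>, by recomputing the current
  position from the history and choosing such a move. If conversely every position with such a move
  belongs to \<open>W\<close>, then, as \<open>k\<close> decreases along plays, all positions won by S lie in \<open>W\<close>. The set of
  positions \<open>(k, \<A>, \<B>)\<close> in which \<open>\<A>\<close> and \<open>\<B>\<close> are separated by a formula of width at most \<open>k\<close> has
  both properties: S's possible choices for a connective are exactly the witnesses for the fact that
  a formula with this main connective separates \<open>\<A>\<close> from \<open>\<B>\<close>.\<close>

lemma all_index_iff: "(\<forall>i. P i) \<longleftrightarrow> P One \<and> P Two"
  by (metis index.exhaust)

lemma ex_index_iff: "(\<exists>i. P i) \<longleftrightarrow> P One \<or> P Two"
  by (metis index.exhaust)

text \<open>Separation by a predicate instead of a formula can be negated, which exchanges the roles of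
  \<open>\<A>\<close> and \<open>\<B>\<close> and so reduces three of the connectives to their duals.\<close>

definition pred_separates :: "('a \<Rightarrow> bool) \<Rightarrow> 'a set \<Rightarrow> 'a set \<Rightarrow> bool" where
  "pred_separates P \<A> \<B> \<longleftrightarrow> (\<forall>A\<in>\<A>. P A) \<and> (\<forall>B\<in>\<B>. \<not> P B)"

lemma pred_separates_not_iff: "pred_separates (\<lambda>T. \<not> P T) \<A> \<B> \<longleftrightarrow> pred_separates P \<B> \<A>"
  by (auto simp: pred_separates_def)

lemma separates_iff_pred_separates: "separates \<phi> \<A> \<B> \<longleftrightarrow> pred_separates (\<lambda>T. T \<Turnstile> \<phi>) \<A> \<B>"
  by (simp add: separates_def pred_separates_def)

lemma ex_cover_pred_separates_iff:
  "(\<exists>\<A>1 \<A>2. \<A>1 \<subseteq> \<A> \<and> \<A>2 \<subseteq> \<A> \<and> \<A>1 \<union> \<A>2 = \<A> \<and>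
      (\<forall>i. pred_separates (P i) (component i (\<A>1, \<A>2)) \<B>))
   \<longleftrightarrow> pred_separates (\<lambda>T. \<exists>i. P i T) \<A> \<B>" (is "?cover \<longleftrightarrow> ?separates")
proof
  assume ?cover
  then show ?separates
    by (auto simp: pred_separates_def all_index_iff ex_index_iff)
next
  assume ?separates
  define part where "part i = {A \<in> \<A>. P i A}" for i
  have "part One \<union> part Two = \<A>"
    using \<open>?separates\<close> by (auto simp: part_def pred_separates_def ex_index_iff)
  moreover have "pred_separates (P i) (part i) \<B>" for i
    using \<open>?separates\<close> unfolding part_def pred_separates_def by blast
  ultimately show ?cover
    by (intro exI[of _ "part One"] exI[of _ "part Two"]) (auto simp: all_index_iff)
qed

lemma ball_chosen_parts_iff:
  "(\<forall>X\<in>chosen_parts g i \<T>. P X) \<longleftrightarrow> (\<forall>T\<in>\<T>. P (component i (g T)))"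
  by (auto simp: chosen_parts_def)

lemma ball_indexed_parts_iff:
  "(\<forall>i. \<forall>X\<in>indexed_parts splits f i \<T>. P i X)
   \<longleftrightarrow> (\<forall>T\<in>\<T>. \<forall>s\<in>splits T. P (f T s) (component (f T s) s))"
  unfolding indexed_parts_def by blast

lemma ex_split_choice_iff:
  "(\<exists>g. (\<forall>T\<in>\<T>. g T \<in> splits T) \<and> (\<forall>i. \<forall>X\<in>chosen_parts g i \<T>. P i X))
   \<longleftrightarrow> (\<forall>T\<in>\<T>. \<exists>s\<in>splits T. \<forall>i. P i (component i s))" (is "?choice \<longleftrightarrow> ?splits")
proof -
  have "?choice \<longleftrightarrow> (\<exists>g. \<forall>T\<in>\<T>. g T \<in> splits T \<and> (\<forall>i. P i (component i (g T))))"
    unfolding ball_chosen_parts_iff ball_conj_distrib by blast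
  also have "\<dots> \<longleftrightarrow> ?splits"
    unfolding Bex_def by (rule bchoice_iff[symmetric])
  finally show ?thesis .
qed

lemma ex_index_choice_iff:
  "(\<exists>f. \<forall>i. \<forall>X\<in>indexed_parts splits f i \<T>. P i X)
   \<longleftrightarrow> (\<forall>T\<in>\<T>. \<forall>s\<in>splits T. \<exists>i. P i (component i s))"
  unfolding ball_indexed_parts_iff bchoice_iff ..

lemma ex_split_choices_pred_separates_iff:
  "(\<exists>g f. (\<forall>A\<in>\<A>. g A \<in> splits A) \<and>
      (\<forall>i. pred_separates (P i) (chosen_parts g i \<A>) (indexed_parts splits f i \<B>)))
   \<longleftrightarrow> pred_separates (\<lambda>T. \<exists>s\<in>splits T. \<forall>i. P i (component i s)) \<A> \<B>"
proof -
  have "(\<exists>g f. (\<forall>A\<in>\<A>. g A \<in> splits A) \<and>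
      (\<forall>i. pred_separates (P i) (chosen_parts g i \<A>) (indexed_parts splits f i \<B>)))
    \<longleftrightarrow> (\<exists>g. (\<forall>A\<in>\<A>. g A \<in> splits A) \<and> (\<forall>i. \<forall>X\<in>chosen_parts g i \<A>. P i X)) \<and>
        (\<exists>f. \<forall>i. \<forall>X\<in>indexed_parts splits f i \<B>. \<not> P i X)"
    unfolding pred_separates_def by blast
  then show ?thesis
    unfolding ex_split_choice_iff ex_index_choice_iff pred_separates_def by blast
qed

text \<open>The conjunctive connectives appear as negated disjunctive ones so that
  \<open>pred_separates_not_iff\<close> applies.\<close>

lemma sat_Conn_component_iff:
  "T \<Turnstile> Conn Bool_Or \<psi> \<theta> \<longleftrightarrow> (\<exists>i. T \<Turnstile> component i (\<psi>, \<theta>))"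
  "T \<Turnstile> Conn And \<psi> \<theta> \<longleftrightarrow> \<not> (\<exists>i. \<not> T \<Turnstile> component i (\<psi>, \<theta>))"
  "T \<Turnstile> Conn Split_Or \<psi> \<theta> \<longleftrightarrow> (\<exists>s\<in>Sp T. \<forall>i. component i s \<Turnstile> component i (\<psi>, \<theta>))"
  "T \<Turnstile> Conn Split_And \<psi> \<theta> \<longleftrightarrow> \<not> (\<exists>s\<in>Sp T. \<forall>i. \<not> component i s \<Turnstile> component i (\<psi>, \<theta>))"
  "T \<Turnstile> Conn Strict_Or \<psi> \<theta> \<longleftrightarrow> (\<exists>s\<in>SSp T. \<forall>i. component i s \<Turnstile> component i (\<psi>, \<theta>))"
  "T \<Turnstile> Conn Strict_And \<psi> \<theta> \<longleftrightarrow> \<not> (\<exists>s\<in>SSp T. \<forall>i. \<not> component i s \<Turnstile> component i (\<psi>, \<theta>))"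
  by (auto simp: Bex_def all_index_iff ex_index_iff)

lemma ex_choice_iff:
  "(\<exists>ch. P ch) \<longleftrightarrow>
     (\<exists>\<A>1 \<A>2. P (Bool_Or_Choice \<A>1 \<A>2)) \<or> (\<exists>\<B>1 \<B>2. P (And_Choice \<B>1 \<B>2)) \<or>
     (\<exists>g f. P (Split_Or_Choice g f)) \<or> (\<exists>g f. P (Split_And_Choice g f)) \<or>
     (\<exists>g f. P (Strict_Or_Choice g f)) \<or> (\<exists>g f. P (Strict_And_Choice g f))"
  (is "_ \<longleftrightarrow> ?cases")
proof
  assume "\<exists>ch. P ch"
  then obtain ch where "P ch" ..
  then show ?cases by (cases ch) blast+
next
  assume ?cases
  then show "\<exists>ch. P ch" by blast
qed

definition separates_next ::
  "'p form \<Rightarrow> 'p form \<Rightarrow> 'p team set \<Rightarrow> 'p team set \<Rightarrow> 'p choice \<Rightarrow> bool" where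
  "separates_next \<psi> \<theta> \<A> \<B> ch \<longleftrightarrow>
     (\<forall>i. case next_sets \<A> \<B> ch i of (\<A>', \<B>') \<Rightarrow> separates (component i (\<psi>, \<theta>)) \<A>' \<B>')"

lemma separates_Conn_iff:
  "separates (Conn c \<psi> \<theta>) \<A> \<B> \<longleftrightarrow>
   (\<exists>ch. connective_of ch = c \<and> admissible \<A> \<B> ch \<and> separates_next \<psi> \<theta> \<A> \<B> ch)"
proof -
  note cover = ex_cover_pred_separates_iff[symmetric]
    and split_choices = ex_split_choices_pred_separates_iff[symmetric]
    and choice_simps = separates_next_def separates_iff_pred_separates sat_Conn_component_iff
      pred_separates_not_iff ex_choice_iff connective_of.simps connective.distinct
      admissible.simps next_sets.simps case_prod_conv conj_assoc simp_thms
  let ?sat = "\<lambda>i T. T \<Turnstile> component i (\<psi>, \<theta>)"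
  let ?unsat = "\<lambda>i T. \<not> T \<Turnstile> component i (\<psi>, \<theta>)"
  show ?thesis
  proof (cases c)
    case Bool_Or
    show ?thesis using cover[of ?sat] by (simp only: Bool_Or choice_simps)
  next
    case And
    show ?thesis using cover[of ?unsat] by (simp only: And choice_simps)
  next
    case Split_Or
    show ?thesis using split_choices[of Sp ?sat] by (simp only: Split_Or choice_simps)
  next
    case Split_And
    show ?thesis using split_choices[of Sp ?unsat] by (simp only: Split_And choice_simps)
  next
    case Strict_Or
    show ?thesis using split_choices[of SSp ?sat] by (simp only: Strict_Or choice_simps)
  next
    case Strict_And
    show ?thesis using split_choices[of SSp ?unsat] by (simp only: Strict_And choice_simps)
  qed
qed

fun next_position :: "'p position \<Rightarrow> 'p move \<times> index \<Rightarrow> 'p position" where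
  "next_position (k, \<A>, \<B>) (Connective_Move k1 k2 ch, i) =
     (component i (k1, k2), next_sets \<A> \<B> ch i)"
| "next_position p (Literal_Move l, i) = p"

lemma reached_imp_foldl_next_position:
  "reached \<Phi> \<Sigma> \<sigma> p0 h p \<Longrightarrow> foldl next_position p0 h = p"
  by (induction rule: reached.induct) simp_all

fun forcing_move ::
  "'p set \<Rightarrow> connective set \<Rightarrow> ('p position \<Rightarrow> bool) \<Rightarrow> 'p position \<Rightarrow> 'p move \<Rightarrow> bool" where
  "forcing_move \<Phi> \<Sigma> W (k, \<A>, \<B>) (Literal_Move l) \<longleftrightarrow>
     legal \<Phi> \<Sigma> (k, \<A>, \<B>) (Literal_Move l) \<and> separates (Lit l) \<A> \<B>"
| "forcing_move \<Phi> \<Sigma> W (k, \<A>, \<B>) (Connective_Move k1 k2 ch) \<longleftrightarrow>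
     legal \<Phi> \<Sigma> (k, \<A>, \<B>) (Connective_Move k1 k2 ch) \<and>
     (\<forall>i. W (component i (k1, k2), next_sets \<A> \<B> ch i))"

lemma forcing_imp_winning_strategy:
  assumes "W p0"
    and forcing: "\<And>h p. reached \<Phi> \<Sigma> \<sigma> p0 h p \<Longrightarrow> W p \<Longrightarrow> forcing_move \<Phi> \<Sigma> W p (\<sigma> h)"
  shows "winning_strategy \<Phi> \<Sigma> p0 \<sigma>"
  unfolding winning_strategy_def
proof (intro allI impI)
  have reached_in_W: "W p" if "reached \<Phi> \<Sigma> \<sigma> p0 h p" for h p
    using that
  proof induction
    case 1
    show ?case by fact
  next
    case (2 h k \<A> \<B> k1 k2 ch i)
    then show ?case using forcing[of h "(k, \<A>, \<B>)"] by simp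
  qed
  fix h k \<A> \<B>
  assume "reached \<Phi> \<Sigma> \<sigma> p0 h (k, \<A>, \<B>)"
  then have "forcing_move \<Phi> \<Sigma> W (k, \<A>, \<B>) (\<sigma> h)"
    using forcing reached_in_W by blast
  then show "legal \<Phi> \<Sigma> (k, \<A>, \<B>) (\<sigma> h) \<and> (\<forall>l. \<sigma> h = Literal_Move l \<longrightarrow> separates (Lit l) \<A> \<B>)"
    by (cases "\<sigma> h") simp_all
qed

lemma ex_forcing_moves_imp_ex_winning_strategy:
  assumes "W p0" and ex_forcing: "\<And>p. W p \<Longrightarrow> \<exists>m. forcing_move \<Phi> \<Sigma> W p m"
  shows "\<exists>\<sigma>. winning_strategy \<Phi> \<Sigma> p0 \<sigma>"
proof -
  obtain move where move: "\<And>p. W p \<Longrightarrow> forcing_move \<Phi> \<Sigma> W p (move p)"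
    using ex_forcing by metis
  define \<sigma> where "\<sigma> h = move (foldl next_position p0 h)" for h
  have "forcing_move \<Phi> \<Sigma> W p (\<sigma> h)" if "reached \<Phi> \<Sigma> \<sigma> p0 h p" "W p" for h p
    using that(1)[THEN reached_imp_foldl_next_position] move[OF that(2)] by (simp add: \<sigma>_def)
  with \<open>W p0\<close> have "winning_strategy \<Phi> \<Sigma> p0 \<sigma>"
    by (rule forcing_imp_winning_strategy)
  then show ?thesis by blast
qed

lemma reached_imp_in_forcing_closed:
  assumes win: "winning_strategy \<Phi> \<Sigma> p0 \<sigma>"
    and closed: "\<And>p m. forcing_move \<Phi> \<Sigma> W p m \<Longrightarrow> W p"
  shows "reached \<Phi> \<Sigma> \<sigma> p0 h (k, \<A>, \<B>) \<Longrightarrow> W (k, \<A>, \<B>)"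
proof (induction k arbitrary: h \<A> \<B> rule: less_induct)
  case (less k)
  have legal: "legal \<Phi> \<Sigma> (k, \<A>, \<B>) (\<sigma> h)"
    and separates: "\<And>l. \<sigma> h = Literal_Move l \<Longrightarrow> separates (Lit l) \<A> \<B>"
    using win less.prems unfolding winning_strategy_def by blast+
  have "forcing_move \<Phi> \<Sigma> W (k, \<A>, \<B>) (\<sigma> h)"
  proof (cases "\<sigma> h")
    case (Literal_Move l)
    then show ?thesis using legal separates by simp
  next
    case (Connective_Move k1 k2 ch)
    have "W (component i (k1, k2), next_sets \<A> \<B> ch i)" for i
    proof -
      have "component i (k1, k2) < k"
        using legal Connective_Move connective_move_decreases by metis
      moreover have "reached \<Phi> \<Sigma> \<sigma> p0 (h @ [(\<sigma> h, i)]) (component i (k1, k2), next_sets \<A> \<B> ch i)"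
        using less.prems Connective_Move legal by (rule reached.intros)
      ultimately show ?thesis
        using less.IH by (cases "next_sets \<A> \<B> ch i") simp
    qed
    then show ?thesis using legal Connective_Move by simp
  qed
  then show ?case by (rule closed)
qed

lemma ex_winning_strategy_iff_fixed_point:
  assumes "\<And>p. W p \<longleftrightarrow> (\<exists>m. forcing_move \<Phi> \<Sigma> W p m)"
  shows "(\<exists>\<sigma>. winning_strategy \<Phi> \<Sigma> p0 \<sigma>) \<longleftrightarrow> W p0"
proof
  assume "\<exists>\<sigma>. winning_strategy \<Phi> \<Sigma> p0 \<sigma>"
  then obtain \<sigma> where "winning_strategy \<Phi> \<Sigma> p0 \<sigma>" ..
  then show "W p0"
    using reached_imp_in_forcing_closed[of \<Phi> \<Sigma> p0 \<sigma> W] assms reached.intros(1)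
    by (cases p0) blast
next
  assume "W p0"
  then show "\<exists>\<sigma>. winning_strategy \<Phi> \<Sigma> p0 \<sigma>"
    using assms by (intro ex_forcing_moves_imp_ex_winning_strategy[of W]) blast+
qed

fun separable :: "'p set \<Rightarrow> connective set \<Rightarrow> 'p position \<Rightarrow> bool" where
  "separable \<Phi> \<Sigma> (k, sides) \<longleftrightarrow>
     (\<exists>\<phi>\<in>PL \<Phi> \<Sigma>. wd \<phi> \<le> k \<and> (case sides of (\<A>, \<B>) \<Rightarrow> separates \<phi> \<A> \<B>))"

lemma separable_next_sets_iff:
  "(\<forall>i. separable \<Phi> \<Sigma> (component i (k1, k2), next_sets \<A> \<B> ch i)) \<longleftrightarrow>
   (\<exists>\<psi>\<in>PL \<Phi> \<Sigma>. \<exists>\<theta>\<in>PL \<Phi> \<Sigma>. wd \<psi> \<le> k1 \<and> wd \<theta> \<le> k2 \<and> separates_next \<psi> \<theta> \<A> \<B> ch)"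
  by (auto simp: all_index_iff separates_next_def) blast

lemma wd_pos: "wd \<phi> > 0"
  by (induction \<phi>) auto

lemma separable_imp_ex_forcing_move:
  assumes "separable \<Phi> \<Sigma> (k, \<A>, \<B>)"
  shows "\<exists>m. forcing_move \<Phi> \<Sigma> (separable \<Phi> \<Sigma>) (k, \<A>, \<B>) m"
proof -
  obtain \<phi> where "\<phi> \<in> PL \<Phi> \<Sigma>" and wd_\<phi>: "wd \<phi> \<le> k" and separates_\<phi>: "separates \<phi> \<A> \<B>"
    using assms by auto
  then show ?thesis
  proof cases
    case (1 l)
    then have "forcing_move \<Phi> \<Sigma> (separable \<Phi> \<Sigma>) (k, \<A>, \<B>) (Literal_Move l)"
      using wd_\<phi> separates_\<phi> by simp
    then show ?thesis ..
  next
    case (2 c \<psi> \<theta>)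
    then obtain ch where ch_admissible: "connective_of ch = c" "admissible \<A> \<B> ch"
      and "separates_next \<psi> \<theta> \<A> \<B> ch"
      using separates_\<phi> separates_Conn_iff by metis
    moreover have "wd \<theta> \<le> k - wd \<psi>"
      using 2 wd_\<phi> by simp
    ultimately have "\<forall>i. separable \<Phi> \<Sigma> (component i (wd \<psi>, k - wd \<psi>), next_sets \<A> \<B> ch i)"
      unfolding separable_next_sets_iff using 2 by blast
    moreover have "legal \<Phi> \<Sigma> (k, \<A>, \<B>) (Connective_Move (wd \<psi>) (k - wd \<psi>) ch)"
      using 2 ch_admissible wd_\<phi> wd_pos[of \<psi>] wd_pos[of \<theta>] by simp
    ultimately have
      "forcing_move \<Phi> \<Sigma> (separable \<Phi> \<Sigma>) (k, \<A>, \<B>) (Connective_Move (wd \<psi>) (k - wd \<psi>) ch)"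
      by simp
    then show ?thesis ..
  qed
qed

lemma forcing_move_imp_separable:
  assumes "forcing_move \<Phi> \<Sigma> (separable \<Phi> \<Sigma>) (k, \<A>, \<B>) m"
  shows "separable \<Phi> \<Sigma> (k, \<A>, \<B>)"
proof (cases m)
  case (Literal_Move l)
  then show ?thesis
    using assms by (auto intro!: bexI[of _ "Lit l"] PL.intros)
next
  case (Connective_Move k1 k2 ch)
  then have ch_admissible: "connective_of ch \<in> \<Sigma>" "admissible \<A> \<B> ch" and k_eq: "k = k1 + k2"
    and "\<forall>i. separable \<Phi> \<Sigma> (component i (k1, k2), next_sets \<A> \<B> ch i)"
    using assms by auto
  then obtain \<psi> \<theta> where PL: "\<psi> \<in> PL \<Phi> \<Sigma>" "\<theta> \<in> PL \<Phi> \<Sigma>" and wd: "wd \<psi> \<le> k1" "wd \<theta> \<le> k2"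
    and "separates_next \<psi> \<theta> \<A> \<B> ch"
    unfolding separable_next_sets_iff by blast
  then have "separates (Conn (connective_of ch) \<psi> \<theta>) \<A> \<B>"
    using ch_admissible(2) separates_Conn_iff by blast
  moreover have "Conn (connective_of ch) \<psi> \<theta> \<in> PL \<Phi> \<Sigma>"
    using ch_admissible(1) PL by (rule PL.intros)
  moreover have "wd (Conn (connective_of ch) \<psi> \<theta>) \<le> k"
    using wd k_eq by simp
  ultimately show ?thesis by (auto simp del: wd.simps)
qed

lemma separable_iff_ex_forcing_move:
  "separable \<Phi> \<Sigma> p \<longleftrightarrow> (\<exists>m. forcing_move \<Phi> \<Sigma> (separable \<Phi> \<Sigma>) p m)"
  using separable_imp_ex_forcing_move forcing_move_imp_separable by (cases p) blast

theorem theorem3p2: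
  fixes \<Phi> :: "'p set" and \<Sigma> :: "connective set"
    and \<A>0 \<B>0 :: "'p team set" and k0 :: nat
  assumes "finite \<Phi>" and "\<A>0 \<subseteq> teams \<Phi>" and "\<B>0 \<subseteq> teams \<Phi>"
  shows "S_has_winning_strategy \<Phi> \<Sigma> k0 \<A>0 \<B>0 \<longleftrightarrow>
         (\<exists>\<phi> \<in> PL \<Phi> \<Sigma>. wd \<phi> \<le> k0 \<and> separates \<phi> \<A>0 \<B>0)"
proof -
  have "S_has_winning_strategy \<Phi> \<Sigma> k0 \<A>0 \<B>0 \<longleftrightarrow> separable \<Phi> \<Sigma> (k0, \<A>0, \<B>0)"
    unfolding S_has_winning_strategy_def
    using separable_iff_ex_forcing_move by (rule ex_winning_strategy_iff_fixed_point)
  then show ?thesis by simp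
qed

end
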